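(* Let $(L,[-])$ be an ordinary Lie algebra over a field $\Bbbk$ and let $\alpha,\beta:L\to L$ be two commuting linear maps such that $\alpha([a,a'])=[\alpha(a),\alpha(a')]$ and $\beta([a,a'])=[\beta(a),\beta(a')]$ for all $a,a'\in L$. Define the linear map $\{-\}:L\otimes L\to L$ by $\{a,b\}=[\alpha(a),\beta(b)]$ for all $a,b\in L$. Then $L_{(\alpha,\beta)}:=(L,\{-\},\alpha,\beta)$ is a BiHom-Lie algebra.
   Context: A BiHom-Lie algebra over a field $\Bbbk$ is a 4-tuple $(L,[-],\alpha,\beta)$ with $L$ a $\Bbbk$-vector space, $\alpha,\beta:L\to L$ and $[-]:L\otimes L\to L$, $a\otimes a'\mapsto[a,a']$, linear maps such that for all $a,a',a''\in L$: $\alpha\circ\beta=\beta\circ\alpha$; $\alpha([a',a''])=[\alpha(a'),\alpha(a'')]$ and $\beta([a',a''])=[\beta(a'),\beta(a'')]$; $[\beta(a),\alpha(a')]=-[\beta(a'),\alpha(a)]$ (skew-symmetry); and $[\beta^2(a),[\beta(a'),\alpha(a'')]]+[\beta^2(a'),[\beta(a''),\alpha(a)]]+[\beta^2(a''),[\beta(a),\alpha(a')]]=0$ (BiHom-Jacobi condition). *)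

theory Defs
  imports Complex_Main
begin

text \<open>
  A vector space is a whole type with an explicit scalar multiplication (the locale
  \<^locale>\<open>vector_space\<close>), so both the field and the dimension are arbitrary.
  A linear map out of the tensor square of L is rendered as a bilinear map in two curried arguments.
\<close>

definition bilinear_bracket ::
    "('k::field \<Rightarrow> 'v::ab_group_add \<Rightarrow> 'v) \<Rightarrow> ('v \<Rightarrow> 'v \<Rightarrow> 'v) \<Rightarrow> bool" where
  "bilinear_bracket scale br \<longleftrightarrow>
     (\<forall>x. Vector_Spaces.linear scale scale (\<lambda>y. br x y)) \<and>
     (\<forall>y. Vector_Spaces.linear scale scale (\<lambda>x. br x y))"

text \<open>The field may have characteristic 2, so the bracket is required to be alternating,
  not merely skew-symmetric.\<close>

locale lie_algebra = vector_space scale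
  for scale :: "'k::field \<Rightarrow> 'v::ab_group_add \<Rightarrow> 'v"
    and br :: "'v \<Rightarrow> 'v \<Rightarrow> 'v" +
  assumes bilinear: "bilinear_bracket scale br"
    and alternating: "br a a = 0"
    and jacobi: "br a (br b c) + br b (br c a) + br c (br a b) = 0"

locale bihom_lie_algebra = vector_space scale
  for scale :: "'k::field \<Rightarrow> 'v::ab_group_add \<Rightarrow> 'v"
    and br :: "'v \<Rightarrow> 'v \<Rightarrow> 'v"
    and \<alpha> \<beta> :: "'v \<Rightarrow> 'v" +
  assumes bilinear: "bilinear_bracket scale br"
    and linear_alpha: "Vector_Spaces.linear scale scale \<alpha>"
    and linear_beta: "Vector_Spaces.linear scale scale \<beta>"
    and commute: "\<alpha> \<circ> \<beta> = \<beta> \<circ> \<alpha>"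
    and alpha_bracket: "\<alpha> (br a b) = br (\<alpha> a) (\<alpha> b)"
    and beta_bracket: "\<beta> (br a b) = br (\<beta> a) (\<beta> b)"
    and skew_symmetry: "br (\<beta> a) (\<alpha> b) = - br (\<beta> b) (\<alpha> a)"
    and bihom_jacobi:
      "br (\<beta> (\<beta> a)) (br (\<beta> b) (\<alpha> c)) + br (\<beta> (\<beta> b)) (br (\<beta> c) (\<alpha> a))
         + br (\<beta> (\<beta> c)) (br (\<beta> a) (\<alpha> b)) = 0"

end

theory Submission
  imports Defs
begin

text \<open>Since \<open>\<alpha>\<close> and \<open>\<beta>\<close> commute and preserve the bracket, both BiHom axioms reduce to the Lie
  axioms: skew-symmetry of \<open>{-}\<close> at \<open>a, b\<close> is skew-symmetry of the Lie bracket at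
  \<open>\<alpha>\<beta>a, \<alpha>\<beta>b\<close>, and the BiHom-Jacobi condition at \<open>a, b, c\<close> is the Jacobi identity at
  \<open>\<alpha>\<beta>\<^sup>2a, \<alpha>\<beta>\<^sup>2b, \<alpha>\<beta>\<^sup>2c\<close>.\<close>

lemma bilinear_bracket_compose:
  assumes "bilinear_bracket scale br"
    and "Vector_Spaces.linear scale scale f" and "Vector_Spaces.linear scale scale g"
  shows "bilinear_bracket scale (\<lambda>a b. br (f a) (g b))"
  using assms Vector_Spaces.linear_compose[OF assms(2)] Vector_Spaces.linear_compose[OF assms(3)]
  unfolding bilinear_bracket_def comp_def by blast

text \<open>Polarisation: in the bilinear expansion of \<open>br (a + b) (a + b) = 0\<close> the
  squares vanish, leaving the two mixed terms.\<close>

lemma (in lie_algebra) skew_symmetric: "br a b = - br b a"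
proof -
  have add_left: "br (x + y) z = br x z + br y z"
    and add_right: "br z (x + y) = br z x + br z y" for x y z
    using bilinear unfolding bilinear_bracket_def Vector_Spaces.linear_iff by auto
  have "br a b + br b a = (br a a + br b a) + (br a b + br b b)"
    by (simp add: alternating)
  also have "\<dots> = br (a + b) (a + b)"
    by (simp only: add_left add_right)
  finally show ?thesis
    by (simp add: alternating eq_neg_iff_add_eq_0)
qed

theorem proposition3p16:
  fixes scale :: "'k::field \<Rightarrow> 'v::ab_group_add \<Rightarrow> 'v"
    and br :: "'v \<Rightarrow> 'v \<Rightarrow> 'v"
    and \<alpha> \<beta> :: "'v \<Rightarrow> 'v"
  assumes "lie_algebra scale br"
    and "Vector_Spaces.linear scale scale \<alpha>"
    and "Vector_Spaces.linear scale scale \<beta>"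
    and "\<alpha> \<circ> \<beta> = \<beta> \<circ> \<alpha>"
    and "\<And>a a'. \<alpha> (br a a') = br (\<alpha> a) (\<alpha> a')"
    and "\<And>a a'. \<beta> (br a a') = br (\<beta> a) (\<beta> a')"
  shows "bihom_lie_algebra scale (\<lambda>a b. br (\<alpha> a) (\<beta> b)) \<alpha> \<beta>"
proof -
  interpret lie_algebra scale br by fact
  have comm: "\<alpha> (\<beta> x) = \<beta> (\<alpha> x)" for x
    using assms(4) by (simp add: fun_eq_iff)
  show ?thesis
  proof (intro bihom_lie_algebra.intro vector_space_axioms bihom_lie_algebra_axioms.intro)
    show "bilinear_bracket scale (\<lambda>a b. br (\<alpha> a) (\<beta> b))"
      using bilinear assms(2,3) by (rule bilinear_bracket_compose)
    show "br (\<alpha> (\<beta> a)) (\<beta> (\<alpha> b)) = - br (\<alpha> (\<beta> b)) (\<beta> (\<alpha> a))" for a b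
      unfolding comm by (rule skew_symmetric)
    show "br (\<alpha> (\<beta> (\<beta> a))) (\<beta> (br (\<alpha> (\<beta> b)) (\<beta> (\<alpha> c))))
        + br (\<alpha> (\<beta> (\<beta> b))) (\<beta> (br (\<alpha> (\<beta> c)) (\<beta> (\<alpha> a))))
        + br (\<alpha> (\<beta> (\<beta> c))) (\<beta> (br (\<alpha> (\<beta> a)) (\<beta> (\<alpha> b)))) = 0" for a b c
      \<comment> \<open>Moving every \<open>\<beta>\<close> outside \<open>\<alpha>\<close> and
        through the inner bracket gives each argument the form
        \<open>\<beta> (\<beta> (\<alpha> x))\<close>.\<close>
      unfolding comm assms(6) by (rule jacobi)
  \<comment> \<open>Each map preserves the new bracket because it preserves \<open>br\<close> and
    commutes with the other map.\<close>
  qed (simp_all add: assms(2-6) comm)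
qed

end
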